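(* In the variety of orthomodular lattices, the ternary term $t(x,y,z):=(x+_l y)+_l z$ is both a Mal'cev term and a Csákány term. That is, for every orthomodular lattice $L$ and all $x,y,z\in L$: (Mal'cev term) $t(x,z,z)=x$ and $t(x,x,z)=z$; (Csákány term) $t(x,y,z)=z$ if and only if $x=y$.
   Context: An orthomodular lattice (OML) is an algebra $(L,\lor,\land,',0,1)$ such that $(L,\lor,\land,0,1)$ is a bounded lattice, $'$ is an orthocomplementation ($x\land x'=0$, $x\lor x'=1$, $x''=x$, and $x\le y$ implies $y'\le x'$), and the orthomodular law holds: $x\le y$ implies $y=x\lor(y\land x')$. The operation $+_l$ is defined by $x+_l y:=(x\lor(x'\land y))\land(x'\lor y')$. *)

theory Defs
  imports "HOL-Library.Complemented_Lattices"
begin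

(* The class orthomodular_lattice also carries a binary minus, but it is fixed by
   x - y = inf x (- y), so it adds no structure beyond (L, sup, inf, -, bot, top). *)

definition oml_plus_l :: "'a::orthomodular_lattice \<Rightarrow> 'a \<Rightarrow> 'a"  (infixl "+\<^sub>l" 65)
  where "x +\<^sub>l y = inf (sup x (inf (- x) y)) (sup (- x) (- y))"

definition oml_t :: "'a::orthomodular_lattice \<Rightarrow> 'a \<Rightarrow> 'a \<Rightarrow> 'a"
  where "oml_t x y z = (x +\<^sub>l y) +\<^sub>l z"

end

theory Submission
  imports Defs
begin

text \<open>
  The point is that \<open>(x +\<^sub>l y) +\<^sub>l y = x\<close>: right translation by \<open>y\<close> is an involution. Together with
  \<open>x +\<^sub>l x = bot\<close> and \<open>bot +\<^sub>l y = y\<close> this gives both Mal'cev identities at once. It also gives the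
  Csakany property: right translations are injective and \<open>z = bot +\<^sub>l z\<close>, so
  \<open>(x +\<^sub>l y) +\<^sub>l z = z\<close> forces \<open>x +\<^sub>l y = bot\<close>, and since \<open>bot = y +\<^sub>l y\<close>, this forces \<open>x = y\<close>.

  For the involution, write \<open>s = x +\<^sub>l y\<close>. Replacing \<open>x\<close> by \<open>s\<close>
  interchanges its trace \<open>x \<sqinter> y\<close> on \<open>y\<close> with the trace \<open>- x \<sqinter> y\<close> of its complement: one finds
  \<open>s \<sqinter> y = - x \<sqinter> y\<close> and \<open>- s \<sqinter> y = x \<sqinter> y\<close>, so that a second application undoes the first.
  An orthomodular lattice need not be distributive, but the computations only need two
  consequences of the orthomodular law about a join of orthogonal elements: one part can be
  removed by meeting with its complement (\<open>orthogonal_sup_inf_compl\<close>), and a meet with an element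
  above one of the parts distributes over the join (\<open>orthogonal_sup_inf_distrib\<close>).
\<close>

text \<open>
  This is the orthomodular law for \<open>v \<le> - u\<close>, read through De Morgan's laws.
\<close>
lemma orthogonal_sup_inf_compl:
  fixes u v :: "'a::orthomodular_lattice"
  assumes "u \<le> - v"
  shows "inf (sup u v) (- v) = u"
proof -
  have "sup v (inf (- v) (- u)) = - u"
    by (rule orthomodular[OF compl_le_swap1[OF assms]])
  then have "- sup v (inf (- v) (- u)) = - (- u)"
    by (simp only:)
  then show ?thesis
    by (simp add: ac_simps)
qed

text \<open>
  Both sides lie above \<open>v\<close>, so by the orthomodular law it suffices to compare the parts orthogonal
  to \<open>v\<close>; for the left-hand side this part is \<open>(u \<squnion> v) \<sqinter> - v \<sqinter> y = u \<sqinter> y\<close>.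
\<close>
lemma orthogonal_sup_inf_distrib:
  fixes u v y :: "'a::orthomodular_lattice"
  assumes "u \<le> - v" and "v \<le> y"
  shows "inf (sup u v) y = sup (inf u y) v"
proof -
  let ?w = "inf (sup u v) y"
  have "inf (- v) ?w = inf (inf (sup u v) (- v)) y"
    by (simp only: ac_simps)
  also have "\<dots> = inf u y"
    by (simp only: orthogonal_sup_inf_compl[OF assms(1)])
  finally have "inf (- v) ?w = inf u y" .
  moreover have "v \<le> ?w"
    using assms(2) by simp
  ultimately show ?thesis
    using orthomodular[of v ?w] by (simp only: sup_commute)
qed

lemma oml_plus_l_self: "x +\<^sub>l x = bot"
  by (simp add: oml_plus_l_def)

lemma bot_oml_plus_l: "bot +\<^sub>l x = x"
  by (simp add: oml_plus_l_def)

lemma oml_plus_l_cancel_right: "(x +\<^sub>l y) +\<^sub>l y = x"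
proof -
  let ?s = "x +\<^sub>l y"
  let ?v = "inf (- x) y" and ?w = "inf x y"
  have x_orth: "x \<le> - ?v"
    by simp
  \<comment> \<open>Both \<open>s\<close> and its complement are orthogonal joins with one part below \<open>y\<close>; the other part
    has zero meet with \<open>y\<close>, so the first part is the whole trace on \<open>y\<close>.\<close>
  have s_eq: "?s = sup (inf x (- ?w)) ?v"
    using orthogonal_sup_inf_distrib[OF x_orth, of "sup (- x) (- y)"]
    by (simp add: oml_plus_l_def le_infI1)
  have compl_s_eq: "- ?s = sup (inf (- x) (- ?v)) ?w"
    by (simp add: oml_plus_l_def)
  have "inf ?s y = sup (inf (inf x (- ?w)) y) ?v"
    unfolding s_eq by (rule orthogonal_sup_inf_distrib) (simp_all add: le_infI1)
  also have "inf (inf x (- ?w)) y = inf ?w (- ?w)"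
    by (simp only: ac_simps)
  finally have s_inf: "inf ?s y = ?v"
    by (simp only: inf_compl_bot sup_bot_left)
  have "inf (- ?s) y = sup (inf (inf (- x) (- ?v)) y) ?w"
    unfolding compl_s_eq by (rule orthogonal_sup_inf_distrib) (simp_all add: le_infI1)
  also have "inf (inf (- x) (- ?v)) y = inf ?v (- ?v)"
    by (simp only: ac_simps)
  finally have compl_s_inf: "inf (- ?s) y = ?w"
    by (simp only: inf_compl_bot sup_bot_left)
  have "?w \<le> x"
    by simp
  then have "sup ?w (inf (- ?w) x) = x"
    by (rule orthomodular)
  then have "sup (inf x (- ?w)) ?w = x"
    by (simp only: sup_commute inf_commute)
  then have join: "sup ?s ?w = sup x ?v"
    unfolding s_eq by (metis sup.assoc sup.commute)
  have "?s +\<^sub>l y = inf (sup ?s (inf (- ?s) y)) (- inf ?s y)"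
    by (simp only: oml_plus_l_def compl_inf)
  also have "\<dots> = inf (sup x ?v) (- ?v)"
    by (simp only: s_inf compl_s_inf join)
  also have "\<dots> = x"
    by (rule orthogonal_sup_inf_compl[OF x_orth])
  finally show ?thesis .
qed

theorem theorem19:
  shows "(\<forall>x z :: 'a::orthomodular_lattice. oml_t x z z = x \<and> oml_t x x z = z) \<and>
         (\<forall>x y z :: 'a. oml_t x y z = z \<longleftrightarrow> x = y)"
proof (intro conjI allI)
  fix x y z :: 'a
  show "oml_t x z z = x"
    by (simp add: oml_t_def oml_plus_l_cancel_right)
  show malcev: "oml_t x x z = z" for x z :: 'a
    by (simp add: oml_t_def oml_plus_l_self bot_oml_plus_l)
  show "oml_t x y z = z \<longleftrightarrow> x = y"
  proof
    assume "oml_t x y z = z"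
    then have "x +\<^sub>l y = bot"
      by (metis oml_t_def oml_plus_l_cancel_right oml_plus_l_self)
    then show "x = y"
      by (metis oml_plus_l_cancel_right bot_oml_plus_l)
  next
    assume "x = y"
    then show "oml_t x y z = z"
      by (simp add: malcev)
  qed
qed

end
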